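(* Let $0<L<U$ and $\theta=U/L$. Among all threshold functions $\phi$ of the form described below (for any $\alpha\ge1$), the smallest $\alpha$ for which such a $\phi$ exists — i.e. the best competitive ratio achievable by the Unified Algorithm via such threshold functions — is $\alpha=\ln\theta+1$, and for $\alpha=\ln\theta+1$ the threshold function $\phi^*$ of this form is unique. The admissible form for a given $\alpha$: there exist $\omega\in[\frac1\alpha,1]$ and an increasing differentiable function $\varphi:[\omega,1]\to[0,\infty)$ with $\varphi(y)\ge\frac1\alpha\varphi'(y)$ for all $y\in[\omega,1]$, $\varphi(\omega)=L$, $\varphi(1)\ge U$, such that $\phi(y)=L$ on $[0,\omega]$ and $\phi(y)=\varphi(y)$ on $[\omega,1]$.
   Context: Unified Algorithm with threshold function $\phi:[0,1]\to[0,\infty)$, for the one-way trading problem (rates $b_i\in[L,U]$ arriving online, choose $x_i\ge0$ with $\sum x_i\le1$, gain $\sum b_ix_i$) and for the online knapsack problem (items with ratio $b_i=v_i/w_i\in[L,U]$, infinitesimal weights, accept or reject, capacity 1): set $y^{(0)}=0$; for each arrival $i$ choose $x_i\in\arg\max_{x\in\mathbb S}\big(b_ix-\int_{y^{(i-1)}}^{y^{(i-1)}+x}\phi(\delta)d\delta\big)$ with $\mathbb S=[0,\infty)$ (OTP) or $\{0,w_i\}$ (OKP), set $y^{(i)}=y^{(i-1)}+x_i$, and if $y^{(i)}>1$ set $x_i=0$. A threshold function of the stated form with parameter $\alpha$ makes the algorithm $\alpha$-competitive (i.e. $\mathrm{OPT}/\mathrm{ALG}\le\alpha$ on every instance).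
   Formalization: Ties in the argmax go to the largest maximiser: with arbitrary ties, if all rates equal L the choice x_i=0 is allowed, so ALG=0 while OPT=L. Choices overfilling the capacity are excluded from the argmax; infinitesimal weights mean ratio c+η once all weights are below some ε. *)

theory Defs
  imports "HOL-Analysis.Analysis"
begin

(* Threshold functions [0,1] -> [0,oo) are extensional, so that equality of functions is
   equality on [0,1].  Derivatives at the end points of [\<omega>,1] are one-sided. *)

definition admissible_threshold :: "real \<Rightarrow> real \<Rightarrow> real \<Rightarrow> (real \<Rightarrow> real) \<Rightarrow> bool" where
  "admissible_threshold L U \<alpha> \<phi> \<longleftrightarrow>
     \<phi> \<in> {0..1} \<rightarrow>\<^sub>E {0..} \<and>
     (\<exists>\<omega>\<in>{1 / \<alpha>..1}. \<exists>f f' :: real \<Rightarrow> real.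
        f \<in> {\<omega>..1} \<rightarrow> {0..} \<and>
        mono_on {\<omega>..1} f \<and>
        (\<forall>y\<in>{\<omega>..1}. (f has_real_derivative f' y) (at y within {\<omega>..1})) \<and>
        (\<forall>y\<in>{\<omega>..1}. f y \<ge> 1 / \<alpha> * f' y) \<and>
        f \<omega> = L \<and> f 1 \<ge> U \<and>
        (\<forall>y\<in>{0..\<omega>}. \<phi> y = L) \<and>
        (\<forall>y\<in>{\<omega>..1}. \<phi> y = f y))"

definition surplus :: "(real \<Rightarrow> real) \<Rightarrow> real \<Rightarrow> real \<Rightarrow> real \<Rightarrow> real" where
  "surplus \<phi> b y x = b * x - integral {y..y + x} \<phi>"

(* The decision x for an arrival b when the load is y: a maximiser of the surplus over S.
   As \<phi> lives on [0,1] only (think of it as infinite beyond 1), decisions that would overfill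
   the capacity are discarded here; for S = {0,w} this is exactly the rule that an item with
   y + w > 1 is rejected.  Ties go to the largest maximiser: for b = L and y < \<omega> the
   surplus is constantly 0 near x = 0, and an algorithm that may choose x = 0 there gains
   nothing on an instance with all rates L. *)

definition ua_choice :: "(real \<Rightarrow> real) \<Rightarrow> real set \<Rightarrow> real \<Rightarrow> real \<Rightarrow> real \<Rightarrow> bool" where
  "ua_choice \<phi> S b y x \<longleftrightarrow>
     x \<in> S \<and> y + x \<le> 1 \<and>
     (\<forall>z\<in>S. y + z \<le> 1 \<longrightarrow>
        surplus \<phi> b y z \<le> surplus \<phi> b y x \<and>
        (surplus \<phi> b y z = surplus \<phi> b y x \<longrightarrow> z \<le> x))"

(* The i-th decision is taken from S i.  By the tie-breaking rule there is at most one run on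
   every instance. *)

definition ua_run :: "(real \<Rightarrow> real) \<Rightarrow> (nat \<Rightarrow> real set) \<Rightarrow> real list \<Rightarrow> real list \<Rightarrow> bool" where
  "ua_run \<phi> S bs xs \<longleftrightarrow>
     length xs = length bs \<and>
     (\<forall>i<length bs. ua_choice \<phi> (S i) (bs ! i) (\<Sum>j<i. xs ! j) (xs ! i))"

definition gain :: "real list \<Rightarrow> real list \<Rightarrow> real" where
  "gain bs xs = (\<Sum>i<length bs. bs ! i * xs ! i)"

definition opt :: "(nat \<Rightarrow> real set) \<Rightarrow> real list \<Rightarrow> real" where
  "opt S bs = Sup {gain bs xs | xs.
     length xs = length bs \<and> (\<forall>i<length bs. xs ! i \<in> S i) \<and> (\<Sum>i<length bs. xs ! i) \<le> 1}"

definition otp_competitive :: "real \<Rightarrow> real \<Rightarrow> (real \<Rightarrow> real) \<Rightarrow> real \<Rightarrow> bool" where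
  "otp_competitive L U \<phi> c \<longleftrightarrow>
     (\<forall>bs. set bs \<subseteq> {L..U} \<longrightarrow>
        (\<exists>xs. ua_run \<phi> (\<lambda>_. {0..}) bs xs \<and> opt (\<lambda>_. {0..}) bs \<le> c * gain bs xs))"

(* An item of ratio b and weight w has value b * w, so gain is the accepted value.
   Infinitesimal weights: the ratio c is reached in the limit of vanishing item weights. *)

definition okp_competitive :: "real \<Rightarrow> real \<Rightarrow> (real \<Rightarrow> real) \<Rightarrow> real \<Rightarrow> bool" where
  "okp_competitive L U \<phi> c \<longleftrightarrow>
     (\<forall>\<eta>>0. \<exists>\<epsilon>>0. \<forall>bs ws.
        length ws = length bs \<and> set bs \<subseteq> {L..U} \<and> set ws \<subseteq> {0<..\<epsilon>} \<longrightarrow>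
        (\<exists>xs. ua_run \<phi> (\<lambda>i. {0, ws ! i}) bs xs \<and>
              opt (\<lambda>i. {0, ws ! i}) bs \<le> (c + \<eta>) * gain bs xs))"

end

theory Submission
  imports Defs "HOL-Real_Asymp.Real_Asymp"
begin

text \<open>
  The growth condition makes \<open>f y * exp (- \<alpha> * y)\<close> nonincreasing, so
  \<open>U \<le> L * exp (\<alpha> * (1 - \<omega>)) \<le> L * exp (\<alpha> - 1)\<close>, and at \<open>\<alpha> = ln \<theta> + 1\<close> equality is forced
  throughout.  The competitive ratio of the extremal threshold rests on the identity
  \<open>\<alpha> * integral {0..t} \<phi> = \<phi> t\<close> for \<open>t \<ge> 1 / \<alpha>\<close>: the gain is at least the integral of the
  threshold up to the final load, while OPT essentially only collects further value at ratios
  below the threshold at the final load.  That no smaller ratio is possible holds for every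
  online rule: against the rates \<open>L * \<theta> powr (k / n)\<close>, offered with total weight 1 at each level,
  a ratio \<open>C\<close> at every prefix forces a total load of at least
  \<open>(1 + n * (1 - \<theta> powr (- 1 / n))) / C\<close>, and the capacity is 1.
\<close>

section \<open>Exponential growth\<close>

lemma exp_growth_bound:
  fixes f f' :: "real \<Rightarrow> real"
  assumes "a \<le> b"
    and deriv: "\<And>y. y \<in> {a..b} \<Longrightarrow> (f has_real_derivative f' y) (at y within {a..b})"
    and growth: "\<And>y. y \<in> {a..b} \<Longrightarrow> f' y \<le> \<alpha> * f y"
  shows "f b \<le> f a * exp (\<alpha> * (b - a))"
proof -
  define g where "g = (\<lambda>y. f y * exp (- \<alpha> * y))"
  have g_deriv: "(g has_real_derivative (f' y - \<alpha> * f y) * exp (- \<alpha> * y)) (at y within {a..b})"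
    if "y \<in> {a..b}" for y
    unfolding g_def
    by (rule derivative_eq_intros deriv[OF that] refl | simp add: algebra_simps)+
  have "g b \<le> g a"
  \<comment> \<open>The derivatives at \<open>a\<close> and \<open>b\<close> are only one-sided, so
    they enter through continuity alone; the sign is tested in the open interval.\<close>
  proof (rule DERIV_nonpos_imp_decreasing_open[OF \<open>a \<le> b\<close>])
    show "\<exists>y. (g has_real_derivative y) (at x) \<and> y \<le> 0" if "a < x" "x < b" for x
    proof (intro exI conjI)
      show "(g has_real_derivative (f' x - \<alpha> * f x) * exp (- \<alpha> * x)) (at x)"
        using g_deriv[of x] that by (simp add: at_within_Icc_at)
      show "(f' x - \<alpha> * f x) * exp (- \<alpha> * x) \<le> 0"
        using growth[of x] that by (simp add: mult_le_0_iff)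
    qed
    show "continuous_on {a..b} g"
      using g_deriv by (meson DERIV_continuous continuous_on_eq_continuous_within)
  qed
  then have "g b * exp (\<alpha> * b) \<le> g a * exp (\<alpha> * b)"
    by simp
  then show ?thesis
    by (simp add: g_def mult.assoc flip: exp_add) (simp add: algebra_simps)
qed

text \<open>The \<open>max\<close> glues the constant and the exponential piece into one continuous
  formula: the exponent is 0 exactly up to \<open>1 / \<alpha>\<close>. Monotonicity and
  integrability then need no case split.\<close>

definition exp_threshold :: "real \<Rightarrow> real \<Rightarrow> real \<Rightarrow> real" where
  "exp_threshold L \<alpha> = (\<lambda>y\<in>{0..1}. L * exp (max 0 (\<alpha> * y - 1)))"

lemma admissible_threshold_bound:
  assumes "0 < L" "L < U" "1 \<le> \<alpha>" "admissible_threshold L U \<alpha> \<phi>"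
  shows "ln (U / L) + 1 \<le> \<alpha>"
proof -
  obtain \<omega> and f f' :: "real \<Rightarrow> real" where "\<omega> \<in> {1 / \<alpha>..1}"
    and f: "\<forall>y\<in>{\<omega>..1}. (f has_real_derivative f' y) (at y within {\<omega>..1})"
      "\<forall>y\<in>{\<omega>..1}. f y \<ge> 1 / \<alpha> * f' y" "f \<omega> = L" "f 1 \<ge> U"
    using assms(4) unfolding admissible_threshold_def by blast
  then have \<omega>: "1 / \<alpha> \<le> \<omega>" "\<omega> \<le> 1" by simp_all
  have "f 1 \<le> f \<omega> * exp (\<alpha> * (1 - \<omega>))"
    using \<omega> f(1,2) \<open>1 \<le> \<alpha>\<close> by (intro exp_growth_bound) (auto simp: field_simps)
  moreover have "\<alpha> * (1 - \<omega>) \<le> \<alpha> - 1"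
    using \<omega> \<open>1 \<le> \<alpha>\<close> by (simp add: field_simps)
  ultimately have "U / L \<le> exp (\<alpha> - 1)"
    using f(3,4) \<open>0 < L\<close>
    by (smt (verit) divide_le_eq exp_le_cancel_iff mult.commute mult_left_mono)
  then show ?thesis
    using assms(1,2) ln_le_cancel_iff[of "U / L" "exp (\<alpha> - 1)"] by simp
qed

section \<open>The extremal threshold at the optimal parameter, and its uniqueness\<close>

locale optimal_parameter =
  fixes L U \<alpha> :: real
  assumes L_pos: "0 < L" and L_less_U: "L < U" and alpha_eq: "\<alpha> = ln (U / L) + 1"
begin

abbreviation \<phi> :: "real \<Rightarrow> real" where "\<phi> \<equiv> exp_threshold L \<alpha>"

lemma alpha_gt_1: "1 < \<alpha>"
  using L_pos L_less_U by (simp add: alpha_eq)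

lemma U_eq: "U = L * exp (\<alpha> - 1)"
  using L_pos L_less_U by (simp add: alpha_eq)

lemma phi_low: "0 \<le> y \<Longrightarrow> y \<le> 1 / \<alpha> \<Longrightarrow> \<phi> y = L"
proof -
  assume y: "0 \<le> y" "y \<le> 1 / \<alpha>"
  have "1 / \<alpha> \<le> 1" using alpha_gt_1 by simp
  then have "y \<le> 1" using y by linarith
  moreover have "\<alpha> * y \<le> 1" using y alpha_gt_1 by (simp add: field_simps)
  ultimately show ?thesis using y by (simp add: exp_threshold_def)
qed

lemma phi_high: "1 / \<alpha> \<le> y \<Longrightarrow> y \<le> 1 \<Longrightarrow> \<phi> y = L * exp (\<alpha> * y - 1)"
proof -
  assume y: "1 / \<alpha> \<le> y" "y \<le> 1"
  have "0 < 1 / \<alpha>" using alpha_gt_1 by simp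
  then have "0 \<le> y" using y by linarith
  moreover have "\<alpha> * y \<ge> 1" using y alpha_gt_1 by (simp add: field_simps)
  ultimately show ?thesis using y by (simp add: exp_threshold_def)
qed

lemma exp_threshold_admissible: "admissible_threshold L U \<alpha> \<phi>"
  unfolding admissible_threshold_def
proof (intro conjI bexI exI ballI)
  let ?f = "\<lambda>y. L * exp (\<alpha> * y - 1)"
  show "\<phi> \<in> {0..1} \<rightarrow>\<^sub>E {0..}"
    using L_pos by (auto simp: exp_threshold_def)
  show "?f \<in> {1 / \<alpha>..1} \<rightarrow> {0..}"
    using L_pos by simp
  show "mono_on {1 / \<alpha>..1} ?f"
    using L_pos alpha_gt_1 by (intro mono_onI) simp
  show "(?f has_real_derivative \<alpha> * ?f y) (at y within {1 / \<alpha>..1})" for y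
    by (rule derivative_eq_intros refl | simp)+
  show "1 / \<alpha> * (\<alpha> * ?f y) \<le> ?f y" for y
    using alpha_gt_1 by simp
  show "?f (1 / \<alpha>) = L" "U \<le> ?f 1"
    using alpha_gt_1 U_eq by simp_all
  show "\<phi> y = L" if "y \<in> {0..1 / \<alpha>}" for y
    using phi_low that by simp
  show "\<phi> y = ?f y" if "y \<in> {1 / \<alpha>..1}" for y
    using phi_high that by simp
  show "1 / \<alpha> \<in> {1 / \<alpha>..1}"
    using alpha_gt_1 by simp
qed

text \<open>Growth over all of \<open>{\<omega>..1}\<close> must reach \<open>U\<close>, which fixes
  \<open>\<omega>\<close>. Then growth on \<open>{\<omega>..y}\<close> bounds \<open>f y\<close>
  from above, and growth on \<open>{y..1}\<close> with \<open>f 1 \<ge> U\<close> bounds it from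
  below, by the same exponential.\<close>

lemma admissible_threshold_unique:
  assumes "admissible_threshold L U \<alpha> \<phi>'"
  shows "\<phi>' = \<phi>"
proof -
  obtain \<omega> and f f' :: "real \<Rightarrow> real" where ext: "\<phi>' \<in> {0..1} \<rightarrow>\<^sub>E {0..}"
    and "\<omega> \<in> {1 / \<alpha>..1}"
    and f: "\<forall>y\<in>{\<omega>..1}. (f has_real_derivative f' y) (at y within {\<omega>..1})"
      "\<forall>y\<in>{\<omega>..1}. f y \<ge> 1 / \<alpha> * f' y" "f \<omega> = L" "f 1 \<ge> U"
    and \<phi>': "\<forall>y\<in>{0..\<omega>}. \<phi>' y = L" "\<forall>y\<in>{\<omega>..1}. \<phi>' y = f y"
    using assms unfolding admissible_threshold_def by blast
  then have \<omega>: "1 / \<alpha> \<le> \<omega>" "\<omega> \<le> 1" by simp_all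
  have bound: "f b \<le> f a * exp (\<alpha> * (b - a))" if "\<omega> \<le> a" "a \<le> b" "b \<le> 1" for a b
    using that f(2) alpha_gt_1
    by (intro exp_growth_bound[where f' = f'] DERIV_subset[OF f(1)[rule_format]])
      (auto simp: field_simps)
  \<comment> \<open>Reaching \<open>U\<close> requires an interval of length at least
    \<open>1 - 1 / \<alpha>\<close>, while \<open>\<omega> \<ge> 1 / \<alpha>\<close> allows no more
    than that.\<close>
  have "L * exp (\<alpha> - 1) \<le> L * exp (\<alpha> * (1 - \<omega>))"
    using bound[of \<omega> 1] \<omega> f(3,4) U_eq by simp
  then have "\<alpha> * \<omega> \<le> 1"
    using L_pos by (simp add: algebra_simps)
  then have \<omega>_eq: "\<omega> = 1 / \<alpha>"
    using \<omega> alpha_gt_1 by (simp add: field_simps)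
  have f_eq: "f y = L * exp (\<alpha> * y - 1)" if "\<omega> \<le> y" "y \<le> 1" for y
  proof (rule antisym)
    show "f y \<le> L * exp (\<alpha> * y - 1)"
      using bound[of \<omega> y] that f(3) \<omega>_eq alpha_gt_1 by (simp add: algebra_simps)
    have "L * exp (\<alpha> - 1) \<le> f y * exp (\<alpha> * (1 - y))"
      using bound[of y 1] that f(4) U_eq by simp
    then have "L * exp (\<alpha> - 1) * exp (- \<alpha> * (1 - y)) \<le> f y * exp (\<alpha> * (1 - y)) * exp (- \<alpha> * (1 - y))"
      by (intro mult_right_mono) simp_all
    then show "L * exp (\<alpha> * y - 1) \<le> f y"
      by (simp add: mult.assoc flip: exp_add) (simp add: algebra_simps)
  qed
  show ?thesis
  proof (rule PiE_ext[OF ext])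
    show "\<phi> \<in> {0..1} \<rightarrow>\<^sub>E {0..}"
      using exp_threshold_admissible by (simp add: admissible_threshold_def)
    show "\<phi>' y = \<phi> y" if "y \<in> {0..1}" for y
      using that \<phi>' f_eq phi_low phi_high \<omega>_eq by (cases "y \<le> \<omega>") auto
  qed
qed

end

section \<open>Runs, gains and optima\<close>

lemma ua_choice_unique: "ua_choice \<phi> S b y x \<Longrightarrow> ua_choice \<phi> S b y x' \<Longrightarrow> x = x'"
  unfolding ua_choice_def by (metis order.antisym)

lemma ua_run_snoc:
  assumes "length xs = length bs"
  shows "ua_run \<phi> S (bs @ [b]) (xs @ [x]) \<longleftrightarrow>
    ua_run \<phi> S bs xs \<and> ua_choice \<phi> (S (length bs)) b (\<Sum>j<length bs. xs ! j) x"
proof -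
  have "(\<Sum>j<i. (xs @ [x]) ! j) = (\<Sum>j<i. xs ! j)" if "i \<le> length bs" for i
    using that assms by (intro sum.cong) (auto simp: nth_append)
  with assms show ?thesis
    by (auto simp: ua_run_def nth_append less_Suc_eq)
qed

lemma ua_run_take: "ua_run \<phi> S bs xs \<Longrightarrow> ua_run \<phi> S (take k bs) (take k xs)"
  by (auto simp: ua_run_def)

text \<open>Equal earlier decisions give equal loads, and the load determines the next decision by
  the tie-breaking rule. The lower bound uses this to identify the run on a prefix with the prefix
  of the run.\<close>

lemma ua_run_unique:
  assumes "ua_run \<phi> S bs xs" "ua_run \<phi> S bs xs'"
  shows "xs = xs'"
proof (rule nth_equalityI)
  show len: "length xs = length xs'"
    using assms by (simp add: ua_run_def)
  have "xs ! i = xs' ! i" if "i < length bs" for i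
    using that
  proof (induction i rule: less_induct)
    case (less i)
    then have "(\<Sum>j<i. xs ! j) = (\<Sum>j<i. xs' ! j)"
      by (intro sum.cong) auto
    with less.prems assms show ?case
      unfolding ua_run_def by (metis ua_choice_unique)
  qed
  then show "xs ! i = xs' ! i" if "i < length xs" for i
    using that assms by (simp add: ua_run_def)
qed

text \<open>This and \<open>opt_cong\<close> exchange families of decision sets that differ only
  past the end of the instance, where \<open>ws ! i\<close> is unspecified.\<close>

lemma ua_run_cong:
  "(\<And>i. i < length bs \<Longrightarrow> S i = S' i) \<Longrightarrow> ua_run \<phi> S bs xs = ua_run \<phi> S' bs xs"
  by (auto simp: ua_run_def)

lemma ua_run_load_le_1:
  assumes "ua_run \<phi> S bs xs" "k \<le> length bs"
  shows "(\<Sum>j<k. xs ! j) \<le> 1"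
proof (cases k)
  case (Suc i)
  with assms have "(\<Sum>j<i. xs ! j) + xs ! i \<le> 1"
    by (auto simp: ua_run_def ua_choice_def)
  with Suc show ?thesis by simp
qed simp

lemma gain_snoc:
  "length xs = length bs \<Longrightarrow> gain (bs @ [b]) (xs @ [x]) = gain bs xs + b * x"
  by (auto simp: gain_def nth_append intro!: sum.cong)

lemma opt_cong:
  "(\<And>i. i < length bs \<Longrightarrow> S i = S' i) \<Longrightarrow> opt S bs = opt S' bs"
  by (simp add: opt_def)

text \<open>A real \<open>Sup\<close> obeys an upper bound only over a nonempty set; the zero
  decisions supply a feasible point.\<close>

lemma opt_least:
  assumes "\<And>i. i < length bs \<Longrightarrow> 0 \<in> S i"
    and "\<And>xs. length xs = length bs \<Longrightarrow> (\<And>i. i < length bs \<Longrightarrow> xs ! i \<in> S i) \<Longrightarrow>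
      (\<Sum>i<length bs. xs ! i) \<le> 1 \<Longrightarrow> gain bs xs \<le> B"
  shows "opt S bs \<le> B"
  unfolding opt_def
proof (rule cSup_least)
  have "gain bs (replicate (length bs) 0) \<in> {gain bs xs | xs. length xs = length bs \<and>
      (\<forall>i<length bs. xs ! i \<in> S i) \<and> (\<Sum>i<length bs. xs ! i) \<le> 1}"
    using assms(1) by (intro CollectI exI[of _ "replicate (length bs) 0"] conjI refl) auto
  then show "{gain bs xs | xs. length xs = length bs \<and>
      (\<forall>i<length bs. xs ! i \<in> S i) \<and> (\<Sum>i<length bs. xs ! i) \<le> 1} \<noteq> {}"
    by blast
qed (use assms(2) in auto)

text \<open>A bound \<open>B\<close> on the rates bounds every feasible gain, because the total
  weight is at most 1. This boundedness is what makes the \<open>Sup\<close> an upper bound.\<close>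

lemma gain_le_opt:
  assumes S: "\<And>i. i < length bs \<Longrightarrow> S i \<subseteq> {0..}"
    and B: "\<And>b. b \<in> set bs \<Longrightarrow> b \<le> B" "0 \<le> B"
    and xs: "length xs = length bs" "\<And>i. i < length bs \<Longrightarrow> xs ! i \<in> S i"
      "(\<Sum>i<length bs. xs ! i) \<le> 1"
  shows "gain bs xs \<le> opt S bs"
  unfolding opt_def
proof (rule cSup_upper)
  show "gain bs xs \<in> {gain bs xs | xs. length xs = length bs \<and>
      (\<forall>i<length bs. xs ! i \<in> S i) \<and> (\<Sum>i<length bs. xs ! i) \<le> 1}"
    using xs by blast
  have "gain bs zs \<le> B" if zs: "length zs = length bs" "\<forall>i<length bs. zs ! i \<in> S i"
    "(\<Sum>i<length bs. zs ! i) \<le> 1" for zs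
  proof -
    have "gain bs zs \<le> (\<Sum>i<length bs. B * zs ! i)"
      unfolding gain_def
    proof (intro sum_mono mult_right_mono)
      fix i assume i: "i \<in> {..<length bs}"
      then show "bs ! i \<le> B" using B(1) by simp
      show "0 \<le> zs ! i" using i zs(2) S[of i] by auto
    qed
    also have "\<dots> \<le> B"
      using zs(3) B(2) by (simp add: mult_left_le flip: sum_distrib_left)
    finally show ?thesis .
  qed
  then show "bdd_above {gain bs xs | xs. length xs = length bs \<and>
      (\<forall>i<length bs. xs ! i \<in> S i) \<and> (\<Sum>i<length bs. xs ! i) \<le> 1}"
    by (intro bdd_aboveI[of _ B]) blast
qed

section \<open>The lower bound on the competitive ratio\<close>

lemma sum_lessThan_mult_Suc:
  fixes h :: "nat \<Rightarrow> 'a::comm_monoid_add"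
  shows "(\<Sum>i<m * Suc k. h i) = (\<Sum>i<m * k. h i) + (\<Sum>r<m. h (m * k + r))"
proof -
  have "(\<Sum>i<a + m. h i) = (\<Sum>i<a. h i) + (\<Sum>r<m. h (a + r))"
    for a and h :: "nat \<Rightarrow> 'a"
    by (induction m) (simp_all add: add.assoc)
  from this[of h "m * k"] show ?thesis
    by (simp add: add.commute)
qed

text \<open>Rate \<open>p k\<close> is offered \<open>m\<close> times, with maximal weight \<open>1 / m\<close> each in the knapsack case.\<close>

definition level_instance :: "nat \<Rightarrow> (nat \<Rightarrow> real) \<Rightarrow> nat \<Rightarrow> real list" where
  "level_instance m p k = map (\<lambda>i. p (i div m)) [0..<m * Suc k]"

lemma length_level_instance [simp]: "length (level_instance m p k) = m * Suc k"
  by (simp add: level_instance_def)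

lemma nth_level_instance: "i < m * Suc k \<Longrightarrow> level_instance m p k ! i = p (i div m)"
  unfolding level_instance_def by (subst nth_map) (simp_all del: upt.simps mult_Suc_right)

lemma take_level_instance:
  assumes "k \<le> n"
  shows "take (m * Suc k) (level_instance m p n) = level_instance m p k"
  unfolding level_instance_def take_map
  by (subst take_upt) (use assms in \<open>simp_all del: mult_Suc_right\<close>)

lemma set_level_instance: "set (level_instance m p k) \<subseteq> p ` {..k}"
proof -
  have "i div m \<le> k" if "i < m * Suc k" for i
    using less_mult_imp_div_less[of i "Suc k" m] that by (simp add: mult.commute)
  then show ?thesis
    by (auto simp: level_instance_def simp del: mult_Suc_right upt.simps)
qed

text \<open>Taking \<open>1 / m\<close> from each of the \<open>m\<close> offers of the last level,
  and nothing before, fills the capacity exactly at rate \<open>p k\<close>.\<close>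

lemma opt_level_instance_ge:
  assumes "0 < m" and S: "\<And>i. 1 / real m \<in> S i" "\<And>i. 0 \<in> S i" "\<And>i. S i \<subseteq> {0..}"
    and p: "\<And>j. j \<le> k \<Longrightarrow> p j \<le> B" "0 \<le> B"
  shows "p k \<le> opt S (level_instance m p k)"
proof -
  define zs where "zs = map (\<lambda>i. if i < m * k then 0 else 1 / real m) [0..<m * Suc k]"
  have zs: "zs ! i = (if i < m * k then 0 else 1 / real m)" if "i < m * Suc k" for i
    unfolding zs_def using that by (subst nth_map) (simp_all del: upt.simps mult_Suc_right)
  have len: "length zs = m * Suc k" by (simp add: zs_def)
  have nth_low: "zs ! i = 0" if "i < m * k" for i
    using zs[of i] that by simp
  have nth_high: "zs ! (m * k + r) = 1 / real m" if "r < m" for r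
    using zs[of "m * k + r"] that by simp
  have "gain (level_instance m p k) zs = (\<Sum>i<m * Suc k. p (i div m) * zs ! i)"
    unfolding gain_def by (intro sum.cong) (simp_all add: nth_level_instance del: mult_Suc_right)
  also have "\<dots> = p k"
    unfolding sum_lessThan_mult_Suc using \<open>0 < m\<close> by (simp add: nth_low nth_high)
  finally have gain: "gain (level_instance m p k) zs = p k" .
  have "(\<Sum>i<m * Suc k. zs ! i) = 1"
    unfolding sum_lessThan_mult_Suc using \<open>0 < m\<close> by (simp add: nth_low nth_high)
  then have "gain (level_instance m p k) zs \<le> opt S (level_instance m p k)"
    using S p len set_level_instance[of m p k]
    by (intro gain_le_opt[where B = B]) (auto simp: zs simp del: mult_Suc_right)
  with gain show ?thesis by simp
qed

text \<open>Gain increments divided by rates are load increments. Summation by parts writes the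
  final load as the final gain over \<open>p n\<close> plus the intermediate gains times
  \<open>1 / p k - 1 / p (Suc k)\<close>. Each gain is at least \<open>p k / C\<close> by
  competitiveness on the prefix, and the load is at most 1.\<close>

lemma level_instance_ratio_bound:
  assumes "0 < m" and S: "\<And>i. 1 / real m \<in> S i" "\<And>i. 0 \<in> S i" "\<And>i. S i \<subseteq> {0..}"
    and p_pos: "\<And>k. 0 < p k" and p_mono: "\<And>k. p k \<le> p (Suc k)"
    and comp: "\<And>k. k \<le> n \<Longrightarrow> \<exists>xs. ua_run \<phi> S (level_instance m p k) xs \<and>
      opt S (level_instance m p k) \<le> C * gain (level_instance m p k) xs"
  shows "1 + (\<Sum>k<n. 1 - p k / p (Suc k)) \<le> C"
proof -
  obtain xs where xs: "ua_run \<phi> S (level_instance m p n) xs"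
    using comp[OF order_refl] by blast
  \<comment> \<open>\<open>T k\<close> and \<open>g k\<close> are load and gain over the first
    \<open>k\<close> levels. Levels are numbered from 0, so the prefix ending with level
    \<open>k\<close> has gain \<open>g (Suc k)\<close>.\<close>
  define T where "T k = (\<Sum>i<m * k. xs ! i)" for k
  define g where "g k = (\<Sum>i<m * k. p (i div m) * xs ! i)" for k
  have xs_nonneg: "0 \<le> xs ! i" if "i < m * Suc n" for i
    using xs that S(3) unfolding ua_run_def ua_choice_def by (auto simp del: mult_Suc_right)
  have g_nonneg: "0 \<le> g (Suc k)" if "k \<le> n" for k
  proof -
    have le: "m * Suc k \<le> m * Suc n"
      using that by (intro mult_le_mono2 Suc_le_mono[THEN iffD2])
    have "0 \<le> p (i div m) * xs ! i" if "i < m * Suc k" for i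
      by (rule mult_nonneg_nonneg[OF less_imp_le[OF p_pos] xs_nonneg[OF order.strict_trans2[OF that le]]])
    then show ?thesis
      unfolding g_def by (intro sum_nonneg) (simp del: mult_Suc_right)
  qed
  have g_ge: "p k \<le> C * g (Suc k)" if "k \<le> n" for k
  proof -
    obtain ys where ys: "ua_run \<phi> S (level_instance m p k) ys"
      "opt S (level_instance m p k) \<le> C * gain (level_instance m p k) ys"
      using comp[OF \<open>k \<le> n\<close>] by blast
    \<comment> \<open>The rule is online: on the shorter instance it decides just as on the initial
      part of the full one.\<close>
    have "ua_run \<phi> S (level_instance m p k) (take (m * Suc k) xs)"
      using ua_run_take[OF xs, of "m * Suc k"] by (simp only: take_level_instance[OF that])
    with ys(1) have "ys = take (m * Suc k) xs"
      by (rule ua_run_unique)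
    then have "gain (level_instance m p k) ys = g (Suc k)"
      unfolding gain_def g_def
      by (intro sum.cong) (simp_all add: nth_level_instance del: mult_Suc_right)
    moreover have "p k \<le> opt S (level_instance m p k)"
      using \<open>0 < m\<close> S p_pos[of k] lift_Suc_mono_le[of p, OF p_mono]
      by (intro opt_level_instance_ge[where B = "p k"]) auto
    ultimately show ?thesis using ys(2) by simp
  qed
  have "0 < C"
    using g_ge[of 0] g_nonneg[of 0] p_pos[of 0] by (smt (verit) le0 mult_nonpos_nonneg)
  have g_Suc: "g (Suc k) = g k + p k * (T (Suc k) - T k)" for k
    unfolding g_def T_def sum_lessThan_mult_Suc using \<open>0 < m\<close> by (simp add: sum_distrib_left)
  \<comment> \<open>Summation by parts as an induction; \<open>g (Suc k) / p k\<close> is the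
    boundary term.\<close>
  have T_ge: "(\<Sum>j<k. 1 - p j / p (Suc j)) / C + g (Suc k) / p k \<le> T (Suc k)" if "k \<le> n" for k
    using that
  proof (induction k)
    case 0
    have "g 0 = 0" "T 0 = 0" by (simp_all add: g_def T_def)
    then show ?case using g_Suc[of 0] p_pos[of 0] by simp
  next
    case (Suc k)
    have nonneg: "0 \<le> 1 - p k / p (Suc k)"
      using p_mono[of k] p_pos[of "Suc k"] by simp
    have "1 / C \<le> g (Suc k) / p k"
      using g_ge[of k] Suc.prems \<open>0 < C\<close> p_pos[of k] by (simp add: field_simps)
    then have "1 / C * (1 - p k / p (Suc k)) \<le> g (Suc k) / p k * (1 - p k / p (Suc k))"
      using nonneg by (rule mult_right_mono)
    then have "(1 - p k / p (Suc k)) / C \<le> g (Suc k) / p k - g (Suc k) / p (Suc k)"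
      using p_pos[of k] by (simp add: right_diff_distrib diff_divide_distrib mult.commute)
    moreover have "T (Suc (Suc k)) = T (Suc k) + (g (Suc (Suc k)) - g (Suc k)) / p (Suc k)"
      using g_Suc[of "Suc k"] p_pos[of "Suc k"] by simp
    ultimately show ?case
      using Suc by (simp add: add_divide_distrib diff_divide_distrib)
  qed
  have "1 / C \<le> g (Suc n) / p n"
    using g_ge[of n] \<open>0 < C\<close> p_pos[of n] by (simp add: field_simps)
  moreover have "T (Suc n) \<le> 1"
    unfolding T_def using ua_run_load_le_1[OF xs, of "m * Suc n"] by simp
  ultimately have "(\<Sum>k<n. 1 - p k / p (Suc k)) / C + 1 / C \<le> 1"
    using T_ge[of n] by simp
  then show ?thesis
    using \<open>0 < C\<close> by (simp add: field_simps)
qed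

text \<open>With \<open>n\<close> geometric steps from \<open>L\<close> to \<open>U\<close>, every
  summand is \<open>1 - exp (- a / n)\<close> for \<open>a = ln (U / L)\<close>, and
  \<open>n\<close> times this tends to \<open>a\<close>.\<close>

lemma geometric_ratio_bound:
  fixes L U C :: real
  assumes "0 < L" "L < U"
    and bound: "\<And>n p. 0 < n \<Longrightarrow> (\<And>k. 0 < p k) \<Longrightarrow> (\<And>k. p k \<le> p (Suc k)) \<Longrightarrow>
      (\<And>k. k \<le> n \<Longrightarrow> p k \<in> {L..U}) \<Longrightarrow> 1 + (\<Sum>k<n. 1 - p k / p (Suc k)) \<le> C"
  shows "ln (U / L) + 1 \<le> C"
proof -
  define a where "a = ln (U / L)"
  have "1 < U / L" using assms(1,2) by (simp add: less_divide_eq)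
  then have "0 < a" and U: "U = L * exp a"
    using assms(1) by (simp_all add: a_def)
  have lower: "1 + real n * (1 - exp (- a / real n)) \<le> C" if "0 < n" for n
  proof -
    define p where "p k = L * exp (a * real k / real n)" for k
    have "p k \<in> {L..U}" if "k \<le> n" for k
      using that \<open>0 < n\<close> \<open>0 < a\<close> \<open>0 < L\<close> by (simp add: p_def U field_simps)
    moreover have "p k \<le> p (Suc k)" "0 < p k" for k
      using \<open>0 < n\<close> \<open>0 < a\<close> \<open>0 < L\<close> by (simp_all add: p_def field_simps)
    ultimately have "1 + (\<Sum>k<n. 1 - p k / p (Suc k)) \<le> C"
      by (intro bound[OF \<open>0 < n\<close>])
    moreover have "p k / p (Suc k) = exp (- a / real n)" for k
      using \<open>0 < n\<close> \<open>0 < L\<close>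
      by (simp add: p_def add_divide_distrib ring_distribs flip: exp_diff)
    ultimately show ?thesis by simp
  qed
  have "(\<lambda>n. 1 + real n * (1 - exp (- a / real n))) \<longlonglongrightarrow> a + 1"
    by real_asymp
  then have "a + 1 \<le> C"
    by (rule LIMSEQ_le_const2) (use lower in \<open>auto intro!: exI[of _ 1]\<close>)
  then show ?thesis by (simp add: a_def)
qed

lemma otp_competitive_bound:
  assumes "0 < L" "L < U" "otp_competitive L U \<phi> c"
  shows "ln (U / L) + 1 \<le> c"
proof (rule geometric_ratio_bound[OF assms(1,2)])
  fix n and p :: "nat \<Rightarrow> real"
  assume p: "\<And>k. 0 < p k" "\<And>k. p k \<le> p (Suc k)" "\<And>k. k \<le> n \<Longrightarrow> p k \<in> {L..U}"
  show "1 + (\<Sum>k<n. 1 - p k / p (Suc k)) \<le> c"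
  \<comment> \<open>A single offer per level suffices, since a trading decision can fill the whole
    capacity at once.\<close>
  proof (rule level_instance_ratio_bound[where m = 1 and S = "\<lambda>_. {0..}" and \<phi> = \<phi>])
    fix k assume "k \<le> n"
    then have "p ` {..k} \<subseteq> {L..U}" using p(3) by fastforce
    then have "set (level_instance 1 p k) \<subseteq> {L..U}"
      using set_level_instance[of 1 p k] by (rule order_trans[rotated])
    then show "\<exists>xs. ua_run \<phi> (\<lambda>_. {0..}) (level_instance 1 p k) xs \<and>
        opt (\<lambda>_. {0..}) (level_instance 1 p k) \<le> c * gain (level_instance 1 p k) xs"
      using assms(3) unfolding otp_competitive_def by blast
  qed (simp_all add: p(1,2))
qed

text \<open>For each \<open>\<eta>\<close>, ratio \<open>c + \<eta>\<close> is guaranteed only for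
  weights up to some \<open>\<epsilon>\<close>. Cutting each level into \<open>m\<close> items of
  weight \<open>1 / m < \<epsilon>\<close> makes the level bound apply to \<open>c + \<eta>\<close>,
  and \<open>\<eta>\<close> is arbitrary.\<close>

lemma okp_competitive_bound:
  assumes "0 < L" "L < U" "okp_competitive L U \<phi> c"
  shows "ln (U / L) + 1 \<le> c"
proof (rule field_le_epsilon, rule geometric_ratio_bound[OF assms(1,2)])
  fix n and p :: "nat \<Rightarrow> real" and \<eta> :: real
  assume p: "\<And>k. 0 < p k" "\<And>k. p k \<le> p (Suc k)" "\<And>k. k \<le> n \<Longrightarrow> p k \<in> {L..U}"
    and "0 < \<eta>"
  obtain \<epsilon> where "0 < \<epsilon>" and
    comp: "\<forall>bs ws. length ws = length bs \<and> set bs \<subseteq> {L..U} \<and> set ws \<subseteq> {0<..\<epsilon>} \<longrightarrow>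
      (\<exists>xs. ua_run \<phi> (\<lambda>i. {0, ws ! i}) bs xs \<and>
        opt (\<lambda>i. {0, ws ! i}) bs \<le> (c + \<eta>) * gain bs xs)"
    using assms(3)[unfolded okp_competitive_def, rule_format, OF \<open>0 < \<eta>\<close>] by blast
  obtain m :: nat where m: "0 < m" "1 / real m < \<epsilon>"
    using nat_approx_posE[OF \<open>0 < \<epsilon>\<close>] by (metis zero_less_Suc)
  show "1 + (\<Sum>k<n. 1 - p k / p (Suc k)) \<le> c + \<eta>"
  proof (rule level_instance_ratio_bound[where m = m and S = "\<lambda>_. {0, 1 / real m}" and \<phi> = \<phi>])
    fix k assume "k \<le> n"
    let ?ws = "replicate (m * Suc k) (1 / real m)" and ?bs = "level_instance m p k"
    have "p ` {..k} \<subseteq> {L..U}" using p(3) \<open>k \<le> n\<close> by fastforce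
    then have "set ?bs \<subseteq> {L..U}"
      using set_level_instance[of m p k] by (rule order_trans[rotated])
    then have "\<exists>xs. ua_run \<phi> (\<lambda>i. {0, ?ws ! i}) ?bs xs \<and>
        opt (\<lambda>i. {0, ?ws ! i}) ?bs \<le> (c + \<eta>) * gain ?bs xs"
      using m by (intro comp[rule_format]) (auto simp del: mult_Suc_right)
    moreover have "ua_run \<phi> (\<lambda>i. {0, ?ws ! i}) ?bs = ua_run \<phi> (\<lambda>_. {0, 1 / real m}) ?bs"
      by (intro ext ua_run_cong) (simp del: mult_Suc_right replicate.simps)
    moreover have "opt (\<lambda>i. {0, ?ws ! i}) ?bs = opt (\<lambda>_. {0, 1 / real m}) ?bs"
      by (intro opt_cong) (simp del: mult_Suc_right replicate.simps)
    ultimately show "\<exists>xs. ua_run \<phi> (\<lambda>_. {0, 1 / real m}) ?bs xs \<and>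
        opt (\<lambda>_. {0, 1 / real m}) ?bs \<le> (c + \<eta>) * gain ?bs xs"
      by simp
  qed (simp_all add: m p(1,2))
qed

section \<open>The competitive ratio of the exponential threshold\<close>

context optimal_parameter
begin

section \<open>The integral of the extremal threshold\<close>

lemma phi_mono: "0 \<le> a \<Longrightarrow> a \<le> b \<Longrightarrow> b \<le> 1 \<Longrightarrow> \<phi> a \<le> \<phi> b"
  using L_pos alpha_gt_1 max.mono[of 0 0 "\<alpha> * a - 1" "\<alpha> * b - 1"]
  by (simp add: exp_threshold_def)

lemma phi_1: "\<phi> 1 = U"
  using phi_high[of 1] alpha_gt_1 U_eq by simp

lemma phi_integrable: "0 \<le> a \<Longrightarrow> b \<le> 1 \<Longrightarrow> \<phi> integrable_on {a..b}"
proof -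
  assume ab: "0 \<le> a" "b \<le> 1"
  have "continuous_on {a..b} (\<lambda>y. L * exp (max 0 (\<alpha> * y - 1)))"
    by (intro continuous_intros)
  then have "(\<lambda>y. L * exp (max 0 (\<alpha> * y - 1))) integrable_on {a..b}"
    by (rule integrable_continuous_interval)
  then show ?thesis
    by (rule integrable_eq) (use ab in \<open>auto simp: exp_threshold_def\<close>)
qed

text \<open>The potential of the analysis: each decision gains at least the increase of
  \<open>\<Phi>\<close> along the load, see \<open>choice_Phi_le\<close>.\<close>

definition \<Phi> :: "real \<Rightarrow> real" where "\<Phi> y = integral {0..y} \<phi>"

lemma Phi_0 [simp]: "\<Phi> 0 = 0"
  by (simp add: \<Phi>_def)

lemma integral_phi:
  assumes "0 \<le> a" "a \<le> b" "b \<le> 1"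
  shows "integral {a..b} \<phi> = \<Phi> b - \<Phi> a"
  using Henstock_Kurzweil_Integration.integral_combine[OF assms(1,2) phi_integrable] assms
  by (simp add: \<Phi>_def)

lemma Phi_diff_bounds:
  assumes "0 \<le> a" "a \<le> b" "b \<le> 1"
  shows "(b - a) * \<phi> a \<le> \<Phi> b - \<Phi> a" and "\<Phi> b - \<Phi> a \<le> (b - a) * \<phi> b"
proof -
  have "integral {a..b} (\<lambda>_. \<phi> a) \<le> integral {a..b} \<phi>" "integral {a..b} \<phi> \<le> integral {a..b} (\<lambda>_. \<phi> b)"
    using assms by (intro integral_le phi_integrable integrable_const_ivl phi_mono; simp)+
  then show "(b - a) * \<phi> a \<le> \<Phi> b - \<Phi> a" "\<Phi> b - \<Phi> a \<le> (b - a) * \<phi> b"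
    using assms by (simp_all add: integral_phi)
qed

lemma phi_pos: "0 \<le> y \<Longrightarrow> y \<le> 1 \<Longrightarrow> 0 < \<phi> y"
  using L_pos by (simp add: exp_threshold_def)

lemma Phi_mono: "0 \<le> a \<Longrightarrow> a \<le> b \<Longrightarrow> b \<le> 1 \<Longrightarrow> \<Phi> a \<le> \<Phi> b"
  using Phi_diff_bounds(1)[of a b] phi_pos[of a] by (smt (verit) mult_nonneg_nonneg)

text \<open>On the exponential piece \<open>\<phi> / \<alpha>\<close> is an antiderivative of
  \<open>\<phi>\<close>. Its value \<open>L / \<alpha>\<close> at \<open>1 / \<alpha>\<close> is
  exactly the area under the constant piece, so no constant of integration remains.\<close>

lemma Phi_high:
  assumes "1 / \<alpha> \<le> t" "t \<le> 1"
  shows "\<Phi> t = \<phi> t / \<alpha>"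
proof -
  have \<omega>: "0 < 1 / \<alpha>" "1 / \<alpha> \<le> 1" using alpha_gt_1 by simp_all
  have "\<Phi> (1 / \<alpha>) = integral {0..1 / \<alpha>} (\<lambda>_. L)"
    unfolding \<Phi>_def by (intro integral_cong) (simp add: phi_low)
  then have low: "\<Phi> (1 / \<alpha>) = L / \<alpha>"
    using \<omega> by simp
  have "((\<lambda>y. L * exp (\<alpha> * y - 1)) has_integral
      L / \<alpha> * exp (\<alpha> * t - 1) - L / \<alpha> * exp (\<alpha> * (1 / \<alpha>) - 1)) {1 / \<alpha>..t}"
    using assms(1) alpha_gt_1
    by (intro fundamental_theorem_of_calculus)
      (auto intro!: derivative_eq_intros simp flip: has_real_derivative_iff_has_vector_derivative)
  then have "integral {1 / \<alpha>..t} (\<lambda>y. L * exp (\<alpha> * y - 1)) = L / \<alpha> * exp (\<alpha> * t - 1) - L / \<alpha>"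
    using alpha_gt_1 by (subst integral_unique) simp_all
  moreover have "integral {1 / \<alpha>..t} \<phi> = integral {1 / \<alpha>..t} (\<lambda>y. L * exp (\<alpha> * y - 1))"
    using assms(2) by (intro integral_cong) (simp add: phi_high)
  ultimately show ?thesis
    using low integral_phi[of "1 / \<alpha>" t] assms \<omega> by (simp add: phi_high)
qed

section \<open>Target loads and one-way trading\<close>

lemma surplus_eq:
  assumes "0 \<le> y" "0 \<le> x" "y + x \<le> 1"
  shows "surplus \<phi> b y x = b * x - (\<Phi> (y + x) - \<Phi> y)"
  using assms by (simp add: surplus_def integral_phi)

text \<open>The inverse of \<open>\<phi>\<close> on the exponential piece. For \<open>b = L\<close>
  it is \<open>1 / \<alpha>\<close>, the far end of the constant piece, in line with ties going to
  the largest maximiser.\<close>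

definition target :: "real \<Rightarrow> real" where "target b = (1 + ln (b / L)) / \<alpha>"

context
  fixes b assumes b: "b \<in> {L..U}"
begin

lemma target_bounds: "1 / \<alpha> \<le> target b" "target b \<le> 1"
proof -
  have "0 \<le> ln (b / L)" "ln (b / L) \<le> \<alpha> - 1"
    using b L_pos by (simp_all add: alpha_eq divide_right_mono)
  then show "1 / \<alpha> \<le> target b" "target b \<le> 1"
    using alpha_gt_1 by (simp_all add: target_def divide_right_mono)
qed

lemma target_nonneg: "0 \<le> target b"
  using target_bounds(1) alpha_gt_1 by (smt (verit) divide_pos_pos)

lemma phi_target: "\<phi> (target b) = b"
  using b L_pos alpha_gt_1 phi_high[OF target_bounds] by (simp add: target_def)

lemma Phi_less_beyond_target:
  assumes "target b \<le> u" "u < v" "v \<le> 1"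
  shows "b * (v - u) < \<Phi> v - \<Phi> u"
proof -
  \<comment> \<open>At \<open>u = target b\<close> the threshold only equals \<open>b\<close>; the
    strict excess comes from the half of the interval beyond the midpoint.\<close>
  define m where "m = (u + v) / 2"
  have m: "u < m" "m < v" using assms by (simp_all add: m_def)
  have "1 / \<alpha> \<le> m" using target_bounds assms m by linarith
  moreover have "\<alpha> * target b < \<alpha> * m" using alpha_gt_1 assms m by simp
  ultimately have "\<phi> (target b) < \<phi> m"
    using assms m L_pos target_bounds by (simp add: phi_high)
  then have "b * (v - m) < \<phi> m * (v - m)"
    using m by (simp add: phi_target)
  also have "\<dots> \<le> \<Phi> v - \<Phi> m"
    using Phi_diff_bounds(1)[of m v] assms m target_nonneg by (simp add: mult.commute)
  finally have 1: "b * (v - m) < \<Phi> v - \<Phi> m" .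
  have "b * (m - u) \<le> \<phi> u * (m - u)"
    using phi_mono[of "target b" u] m assms target_nonneg by (simp add: phi_target mult_right_mono)
  also have "\<dots> \<le> \<Phi> m - \<Phi> u"
    using Phi_diff_bounds(1)[of u m] assms m target_nonneg by (simp add: mult.commute)
  finally show ?thesis using 1 by (simp add: algebra_simps)
qed

lemma Phi_le_before_target:
  assumes "0 \<le> u" "u \<le> v" "v \<le> target b"
  shows "\<Phi> v - \<Phi> u \<le> b * (v - u)"
proof -
  have "\<Phi> v - \<Phi> u \<le> \<phi> v * (v - u)"
    using Phi_diff_bounds(2)[of u v] assms target_bounds by (simp add: mult.commute)
  also have "\<dots> \<le> b * (v - u)"
    using phi_mono[of v "target b"] assms target_bounds by (simp add: phi_target mult_right_mono)
  finally show ?thesis .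
qed

text \<open>As a function of the load reached, the surplus has slope \<open>b - \<phi>\<close>: it
  does not decrease up to \<open>target b\<close> and strictly decreases beyond. Strictness makes
  this point the largest maximiser.\<close>

lemma otp_choice:
  assumes "0 \<le> y" "y \<le> 1"
  shows "ua_choice \<phi> {0..} b y (max 0 (target b - y))"
  unfolding ua_choice_def
proof (intro conjI ballI impI)
  let ?x = "max 0 (target b - y)"
  show "?x \<in> {0..}" "y + ?x \<le> 1"
    using target_bounds assms by auto
  fix z :: real assume z: "z \<in> {0..}" "y + z \<le> 1"
  have eq: "surplus \<phi> b y x = b * x - (\<Phi> (y + x) - \<Phi> y)" if "0 \<le> x" "y + x \<le> 1" for x
    using surplus_eq assms that by simp
  have "z \<le> ?x \<and> surplus \<phi> b y z \<le> surplus \<phi> b y ?x \<or> surplus \<phi> b y z < surplus \<phi> b y ?x"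
  proof (cases "z \<le> ?x")
    case True
    \<comment> \<open>If \<open>?x = 0\<close>, the load may already be past the target, but then
      \<open>z = 0\<close> and both sides vanish. Otherwise \<open>y + ?x\<close> is the target
      itself.\<close>
    then have "\<Phi> (y + ?x) - \<Phi> (y + z) \<le> b * (y + ?x - (y + z))"
      using z assms by (cases "?x = 0") (auto intro!: Phi_le_before_target)
    then have "surplus \<phi> b y z \<le> surplus \<phi> b y ?x"
      using eq[of z] eq[of ?x] z \<open>y + ?x \<le> 1\<close> by (simp add: algebra_simps)
    then show ?thesis using True by simp
  next
    case False
    then have "b * (y + z - (y + ?x)) < \<Phi> (y + z) - \<Phi> (y + ?x)"
      using z by (intro Phi_less_beyond_target) auto
    then have "surplus \<phi> b y z < surplus \<phi> b y ?x"
      using eq[of z] eq[of ?x] z \<open>y + ?x \<le> 1\<close> by (simp add: algebra_simps)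
    then show ?thesis by simp
  qed
  then show "surplus \<phi> b y z \<le> surplus \<phi> b y ?x"
    and "surplus \<phi> b y z = surplus \<phi> b y ?x \<Longrightarrow> z \<le> ?x"
    by auto
qed

end

text \<open>The choice is at least as good as the decision 0, whose surplus is 0.\<close>

lemma choice_Phi_le:
  assumes "0 \<le> y" "0 \<le> x" "0 \<in> S" "ua_choice \<phi> S b y x"
  shows "\<Phi> (y + x) - \<Phi> y \<le> b * x"
proof -
  have "y + x \<le> 1" "surplus \<phi> b y 0 \<le> surplus \<phi> b y x"
    using assms by (auto simp: ua_choice_def)
  then show ?thesis using assms by (simp add: surplus_eq)
qed

lemma otp_run_exists:
  assumes "set bs \<subseteq> {L..U}"
  shows "\<exists>xs. ua_run \<phi> (\<lambda>_. {0..}) bs xs \<and> 0 \<le> (\<Sum>i<length bs. xs ! i) \<and>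
    (\<forall>b\<in>set bs. target b \<le> (\<Sum>i<length bs. xs ! i)) \<and> \<Phi> (\<Sum>i<length bs. xs ! i) \<le> gain bs xs"
  using assms
proof (induction bs rule: rev_induct)
  case Nil
  then show ?case by (simp add: ua_run_def gain_def)
next
  case (snoc b bs)
  then obtain xs where xs: "ua_run \<phi> (\<lambda>_. {0..}) bs xs" "0 \<le> (\<Sum>i<length bs. xs ! i)"
    "\<forall>b\<in>set bs. target b \<le> (\<Sum>i<length bs. xs ! i)" "\<Phi> (\<Sum>i<length bs. xs ! i) \<le> gain bs xs"
    by auto
  define y where "y = (\<Sum>i<length bs. xs ! i)"
  define x where "x = max 0 (target b - y)"
  have len: "length xs = length bs" using xs(1) by (simp add: ua_run_def)
  have "y \<le> 1" unfolding y_def using ua_run_load_le_1[OF xs(1)] by simp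
  then have choice: "ua_choice \<phi> {0..} b y x"
    unfolding x_def using snoc.prems xs(2) by (intro otp_choice) (auto simp: y_def)
  have sum: "(\<Sum>i<length (bs @ [b]). (xs @ [x]) ! i) = y + x"
    using len by (simp add: y_def nth_append)
  have "0 \<le> y" using xs(2) by (simp add: y_def)
  show ?case
  proof (intro exI conjI ballI)
    show "ua_run \<phi> (\<lambda>_. {0..}) (bs @ [b]) (xs @ [x])"
      using choice xs(1) len by (simp add: ua_run_snoc y_def)
    show "0 \<le> (\<Sum>i<length (bs @ [b]). (xs @ [x]) ! i)"
      unfolding sum using \<open>0 \<le> y\<close> by (simp add: x_def)
    show "target b' \<le> (\<Sum>i<length (bs @ [b]). (xs @ [x]) ! i)" if "b' \<in> set (bs @ [b])" for b'
      unfolding sum using that xs(3) by (fastforce simp: x_def y_def)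
    show "\<Phi> (\<Sum>i<length (bs @ [b]). (xs @ [x]) ! i) \<le> gain (bs @ [b]) (xs @ [x])"
      unfolding sum gain_snoc[OF len]
      using choice_Phi_le[OF \<open>0 \<le> y\<close> _ _ choice] xs(4) by (simp add: x_def y_def)
  qed
qed

text \<open>OPT is at most the highest rate. For every rate seen,
  \<open>b / \<alpha> = \<Phi> (target b)\<close>, and the final load is at least
  \<open>target b\<close>, so \<open>b / \<alpha>\<close> is at most the gain.\<close>

lemma exp_threshold_otp_competitive: "otp_competitive L U \<phi> \<alpha>"
  unfolding otp_competitive_def
proof (intro allI impI)
  fix bs :: "real list" assume bs: "set bs \<subseteq> {L..U}"
  obtain xs where xs: "ua_run \<phi> (\<lambda>_. {0..}) bs xs" "0 \<le> (\<Sum>i<length bs. xs ! i)"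
    "\<forall>b\<in>set bs. target b \<le> (\<Sum>i<length bs. xs ! i)" "\<Phi> (\<Sum>i<length bs. xs ! i) \<le> gain bs xs"
    using otp_run_exists[OF bs] by auto
  define y where "y = (\<Sum>i<length bs. xs ! i)"
  have y: "0 \<le> y" "y \<le> 1"
    unfolding y_def using ua_run_load_le_1[OF xs(1)] xs(2) by simp_all
  have gain_nonneg: "0 \<le> \<alpha> * gain bs xs"
    using Phi_mono[of 0 y] y xs(4) alpha_gt_1 by (simp add: y_def)
  have rate_le: "b \<le> \<alpha> * gain bs xs" if "b \<in> set bs" for b
  proof -
    have b: "b \<in> {L..U}" using that bs by auto
    have "b / \<alpha> = \<Phi> (target b)"
      using Phi_high[OF target_bounds[OF b]] phi_target[OF b] by simp
    also have "\<dots> \<le> \<Phi> y"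
      using xs(3) that y target_nonneg[OF b] by (intro Phi_mono) (auto simp: y_def)
    also have "\<dots> \<le> gain bs xs"
      using xs(4) by (simp add: y_def)
    finally show ?thesis
      using alpha_gt_1 by (simp add: field_simps)
  qed
  have "opt (\<lambda>_. {0..}) bs \<le> \<alpha> * gain bs xs"
  proof (rule opt_least)
    fix zs :: "real list"
    assume zs: "length zs = length bs" "\<And>i. i < length bs \<Longrightarrow> zs ! i \<in> {0..}"
      "(\<Sum>i<length bs. zs ! i) \<le> 1"
    have "gain bs zs \<le> (\<Sum>i<length bs. \<alpha> * gain bs xs * zs ! i)"
      unfolding gain_def[of bs zs] using zs(2) rate_le by (intro sum_mono mult_right_mono) auto
    also have "\<dots> \<le> \<alpha> * gain bs xs"
      using zs(3) gain_nonneg by (simp add: mult_left_le flip: sum_distrib_left)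
    finally show "gain bs zs \<le> \<alpha> * gain bs xs" .
  qed simp
  with xs(1) show "\<exists>xs. ua_run \<phi> (\<lambda>_. {0..}) bs xs \<and> opt (\<lambda>_. {0..}) bs \<le> \<alpha> * gain bs xs"
    by blast
qed

section \<open>Online knapsack with small items\<close>

lemma okp_run_exists:
  assumes "\<And>i. 0 < w i"
  shows "\<exists>xs. ua_run \<phi> (\<lambda>i. {0, w i}) bs xs"
proof (induction bs rule: rev_induct)
  case Nil
  then show ?case by (simp add: ua_run_def)
next
  case (snoc b bs)
  then obtain xs where xs: "ua_run \<phi> (\<lambda>i. {0, w i}) bs xs" by auto
  define y where "y = (\<Sum>i<length bs. xs ! i)"
  define v where "v = w (length bs)"
  have len: "length xs = length bs" using xs by (simp add: ua_run_def)
  have "y \<le> 1" "0 < v"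
    unfolding y_def v_def using ua_run_load_le_1[OF xs] assms by simp_all
  then have "ua_choice \<phi> {0, v} b y (if y + v \<le> 1 \<and> surplus \<phi> b y 0 \<le> surplus \<phi> b y v then v else 0)"
    by (auto simp: ua_choice_def)
  then show ?case
    using ua_run_snoc[OF len, of \<phi> "\<lambda>i. {0, w i}" b] xs by (auto simp: y_def v_def)
qed

text \<open>Weak duality with price \<open>\<phi> t\<close> per unit of weight, at a load
  \<open>t\<close> at most \<open>\<epsilon>\<close> above the final one: rejected items have ratio
  at most the price, and accepted ones contribute their value minus their increase of
  \<open>\<Phi>\<close>. Hence OPT is at most \<open>gain bs xs - \<Phi> (y n) + \<phi> t\<close>,
  and \<open>\<phi> t = \<alpha> * \<Phi> t\<close> is close to
  \<open>\<alpha> * \<Phi> (y n)\<close>.\<close>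

lemma okp_run_competitive:
  assumes "0 < \<eta>" and \<epsilon>: "\<epsilon> = \<eta> / (\<alpha> * (\<alpha> + \<eta>))"
    and w: "\<And>i. 0 < w i" "\<And>i. i < length bs \<Longrightarrow> w i \<le> \<epsilon>"
    and bs: "set bs \<subseteq> {L..U}" and run: "ua_run \<phi> (\<lambda>i. {0, w i}) bs xs"
  shows "opt (\<lambda>i. {0, w i}) bs \<le> (\<alpha> + \<eta>) * gain bs xs"
proof -
  define n where "n = length bs"
  define y where "y i = (\<Sum>j<i. xs ! j)" for i
  have y_Suc: "y (Suc i) = y i + xs ! i" for i by (simp add: y_def)
  have choice: "ua_choice \<phi> {0, w i} (bs ! i) (y i) (xs ! i)" if "i < n" for i
    using run that by (simp add: ua_run_def n_def y_def)
  then have xs: "xs ! i = 0 \<or> xs ! i = w i" if "i < n" for i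
    using that by (auto simp: ua_choice_def)
  then have xs_nonneg: "0 \<le> xs ! i" if "i < n" for i
    using that w(1)[of i] by (metis less_imp_le order_refl)
  have y_mono: "y i \<le> y j" if "i \<le> j" "j \<le> n" for i j
    unfolding y_def using that xs_nonneg by (intro sum_mono2) auto
  have y_nonneg: "0 \<le> y i" if "i \<le> n" for i
    using y_mono[of 0 i] that by (simp add: y_def)
  have y_le: "y i \<le> 1" if "i \<le> n" for i
    unfolding y_def using ua_run_load_le_1[OF run] that by (simp add: n_def)
  have rate: "L \<le> bs ! i" "bs ! i \<le> U" if "i < n" for i
    using bs that nth_mem unfolding n_def by (metis atLeastAtMost_iff subsetD)+
  have "0 < \<epsilon>" using \<open>0 < \<eta>\<close> alpha_gt_1 by (simp add: \<epsilon>)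
  have Phi_step: "\<Phi> (y (Suc i)) - \<Phi> (y i) \<le> bs ! i * xs ! i" if "i < n" for i
    unfolding y_Suc using choice[OF that] y_nonneg[of i] xs_nonneg[OF that] that
    by (intro choice_Phi_le) auto
  have "(\<Sum>i<n. \<Phi> (y (Suc i)) - \<Phi> (y i)) = \<Phi> (y n)"
    by (subst sum_lessThan_telescope) (simp add: y_def)
  moreover have "(\<Sum>i<n. \<Phi> (y (Suc i)) - \<Phi> (y i)) \<le> gain bs xs"
    unfolding gain_def n_def[symmetric] using Phi_step by (intro sum_mono) simp
  ultimately have Phi_le_gain: "\<Phi> (y n) \<le> gain bs xs" by simp
  have Phi_nonneg: "0 \<le> \<Phi> (y n)"
    using Phi_mono[of 0 "y n"] y_nonneg y_le by simp
  \<comment> \<open>No rejected item that still fitted would have pushed the load beyond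
    \<open>t\<close>; the cap at 1 stays inside the domain of the threshold.\<close>
  define t where "t = min 1 (y n + \<epsilon>)"
  have t: "y n \<le> t" "t \<le> 1" "t - y n \<le> \<epsilon>" "0 \<le> t"
    using y_le[of n] y_nonneg[of n] \<open>0 < \<epsilon>\<close> by (auto simp: t_def)
  have rejected: "bs ! i \<le> \<phi> t \<and> 1 / \<alpha> \<le> t" if i: "i < n" "xs ! i = 0" for i
  proof (cases "y i + w i \<le> 1")
    case True
    \<comment> \<open>Ties favour the larger decision, so an item that fits is rejected only for
      strictly negative surplus.\<close>
    have "surplus \<phi> (bs ! i) (y i) (w i) < surplus \<phi> (bs ! i) (y i) 0"
      using choice[OF i(1)] i(2) True w(1)[of i] by (auto simp: ua_choice_def order.strict_iff_order)
    then have less: "bs ! i * w i < \<Phi> (y i + w i) - \<Phi> (y i)"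
      using True y_nonneg[of i] i(1) w(1)[of i] by (simp add: surplus_eq)
    also have "\<dots> \<le> w i * \<phi> (y i + w i)"
      using Phi_diff_bounds(2)[of "y i" "y i + w i"] True y_nonneg[of i] i(1) w(1)[of i] by simp
    finally have b_less: "bs ! i < \<phi> (y i + w i)"
      using w(1)[of i] by (simp add: mult.commute)
    have le_t: "y i + w i \<le> t"
      using True y_mono[of i n] i(1) w(2)[of i] by (simp add: t_def n_def)
    \<comment> \<open>On the constant piece the threshold is \<open>L\<close>, which no rate lies
      strictly below. So \<open>t\<close> is in the range of \<open>Phi_high\<close>.\<close>
    have "1 / \<alpha> \<le> y i + w i"
    proof (rule ccontr)
      assume "\<not> ?thesis"
      then have "\<phi> (y i + w i) = L"
        using y_nonneg[of i] i(1) w(1)[of i] by (intro phi_low) auto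
      then show False using b_less rate(1)[OF i(1)] by simp
    qed
    moreover have "\<phi> (y i + w i) \<le> \<phi> t"
      using le_t t y_nonneg[of i] i(1) w(1)[of i] by (intro phi_mono) auto
    ultimately show ?thesis using b_less le_t by linarith
  next
    case False
    \<comment> \<open>The item did not fit, so the final load is within \<open>\<epsilon>\<close> of
      the capacity and the price is \<open>\<phi> 1 = U\<close>.\<close>
    then have "t = 1"
      using y_mono[of i n] i(1) w(2)[of i] by (simp add: t_def n_def)
    then show ?thesis using rate(2)[OF i(1)] phi_1 alpha_gt_1 by simp
  qed
  have gain_mult: "gain bs xs \<le> (\<alpha> + \<eta>) * gain bs xs"
    using alpha_gt_1 \<open>0 < \<eta>\<close> Phi_nonneg Phi_le_gain
    by (intro mult_le_cancel_right1[THEN iffD2]) auto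
  show ?thesis
  proof (rule opt_least)
    fix zs :: "real list"
    assume zs: "length zs = length bs" "\<And>i. i < length bs \<Longrightarrow> zs ! i \<in> {0, w i}"
      "(\<Sum>i<length bs. zs ! i) \<le> 1"
    show "gain bs zs \<le> (\<alpha> + \<eta>) * gain bs xs"
    \<comment> \<open>Without a rejection \<open>t\<close> may lie on the constant piece, out of
      reach of \<open>Phi_high\<close>, but then every item was accepted and no selection does
      better.\<close>
    proof (cases "\<exists>i<n. xs ! i = 0")
      case False
      have "gain bs zs \<le> gain bs xs"
        unfolding gain_def
      proof (intro sum_mono mult_left_mono)
        fix i assume i: "i \<in> {..<length bs}"
        then show "zs ! i \<le> xs ! i"
          using False xs[of i] zs(2)[of i] w(1)[of i] by (auto simp: n_def)
        show "0 \<le> bs ! i"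
          using rate(1)[of i] L_pos i by (simp add: n_def)
      qed
      with gain_mult show ?thesis by simp
    next
      case True
      then have "1 / \<alpha> \<le> t" using rejected by auto
      then have "\<phi> t / \<alpha> = \<Phi> t" using Phi_high t by simp
      also have "\<dots> \<le> \<Phi> (y n) + (t - y n) * \<phi> t"
        using Phi_diff_bounds(2)[of "y n" t] t y_nonneg[of n] by simp
      also have "\<dots> \<le> \<Phi> (y n) + \<epsilon> * \<phi> t"
        using t phi_pos[of t] by (simp add: mult_right_mono)
      finally have "(1 / \<alpha> - \<epsilon>) * \<phi> t \<le> \<Phi> (y n)"
        by (simp add: algebra_simps)
      moreover have "\<alpha> \<noteq> 0" "\<alpha> + \<eta> \<noteq> 0"
        using alpha_gt_1 \<open>0 < \<eta>\<close> by simp_all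
      \<comment> \<open>The value of \<open>\<epsilon>\<close> is the solution of this
        equation.\<close>
      then have "1 / \<alpha> - \<epsilon> = 1 / (\<alpha> + \<eta>)"
        by (simp add: \<epsilon> divide_simps)
      ultimately have phi_t: "\<phi> t \<le> (\<alpha> + \<eta>) * \<Phi> (y n)"
        using alpha_gt_1 \<open>0 < \<eta>\<close> by (simp add: field_simps)
      \<comment> \<open>For an accepted item, \<open>zs ! i = 0\<close> needs that its value covers
        the increase of \<open>\<Phi>\<close>, and \<open>zs ! i = w i\<close> that this increase is
        at most the price of the item. For a rejected one the load is unchanged and the price
        exceeds the ratio or equals it.\<close>
      have item: "bs ! i * zs ! i \<le> bs ! i * xs ! i - (\<Phi> (y (Suc i)) - \<Phi> (y i)) + \<phi> t * zs ! i"
        if i: "i < n" for i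
      proof (cases "xs ! i = 0")
        case True
        then show ?thesis
          using rejected[OF i] zs(2)[of i] i w(1)[of i]
          by (auto simp: y_Suc n_def)
      next
        case False
        then have x: "xs ! i = w i" using xs[OF i] by simp
        have "\<Phi> (y (Suc i)) - \<Phi> (y i) \<le> w i * \<phi> (y (Suc i))"
          using Phi_diff_bounds(2)[of "y i" "y (Suc i)"] y_nonneg[of i] y_le[of "Suc i"] i w(1)[of i] x
          by (simp add: y_Suc)
        also have "\<dots> \<le> w i * \<phi> t"
          using w(1)[of i] y_mono[of "Suc i" n] t y_nonneg[of "Suc i"] i
          by (intro mult_left_mono phi_mono) auto
        finally show ?thesis
          using Phi_step[OF i] x zs(2)[of i] i by (auto simp: n_def mult.commute)
      qed
      have "gain bs zs \<le> (\<Sum>i<n. bs ! i * xs ! i - (\<Phi> (y (Suc i)) - \<Phi> (y i)) + \<phi> t * zs ! i)"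
        unfolding gain_def n_def[symmetric] using item by (intro sum_mono) simp
      also have "\<dots> = gain bs xs - \<Phi> (y n) + \<phi> t * (\<Sum>i<n. zs ! i)"
        using \<open>(\<Sum>i<n. \<Phi> (y (Suc i)) - \<Phi> (y i)) = \<Phi> (y n)\<close>
        unfolding sum.distrib sum_subtractf[of "\<lambda>i. bs ! i * xs ! i"]
        by (simp add: gain_def n_def sum_distrib_left)
      also have "\<dots> \<le> gain bs xs - \<Phi> (y n) + \<phi> t"
        using zs(3) phi_pos[of t] t by (simp add: n_def mult_left_le)
      also have "\<dots> \<le> gain bs xs + (\<alpha> + \<eta> - 1) * \<Phi> (y n)"
        using phi_t by (simp add: algebra_simps)
      also have "\<dots> \<le> gain bs xs + (\<alpha> + \<eta> - 1) * gain bs xs"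
        using Phi_le_gain alpha_gt_1 \<open>0 < \<eta>\<close> by (intro add_left_mono mult_left_mono) auto
      finally show ?thesis by (simp add: algebra_simps)
    qed
  qed simp
qed

lemma exp_threshold_okp_competitive: "okp_competitive L U \<phi> \<alpha>"
  unfolding okp_competitive_def
proof (intro allI impI)
  fix \<eta> :: real assume "0 < \<eta>"
  define \<epsilon> where "\<epsilon> = \<eta> / (\<alpha> * (\<alpha> + \<eta>))"
  have "0 < \<epsilon>" using \<open>0 < \<eta>\<close> alpha_gt_1 by (simp add: \<epsilon>_def)
  moreover have "\<exists>xs. ua_run \<phi> (\<lambda>i. {0, ws ! i}) bs xs \<and>
      opt (\<lambda>i. {0, ws ! i}) bs \<le> (\<alpha> + \<eta>) * gain bs xs"
    if "length ws = length bs" "set bs \<subseteq> {L..U}" "set ws \<subseteq> {0<..\<epsilon>}" for bs ws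
  proof -
    \<comment> \<open>The lemmas on runs ask for positive weights at every index; the default 1
      provides them past the end of the list.\<close>
    define w where "w i = (if i < length ws then ws ! i else 1)" for i
    have "ws ! i \<in> {0<..\<epsilon>}" if "i < length ws" for i
      using \<open>set ws \<subseteq> {0<..\<epsilon>}\<close> nth_mem[OF that] by blast
    then have w: "0 < w i" "i < length bs \<Longrightarrow> w i \<le> \<epsilon>" for i
      using that(1) by (auto simp: w_def)
    obtain xs where xs: "ua_run \<phi> (\<lambda>i. {0, w i}) bs xs"
      using okp_run_exists w(1) by blast
    then have "opt (\<lambda>i. {0, w i}) bs \<le> (\<alpha> + \<eta>) * gain bs xs"
      using okp_run_competitive[OF \<open>0 < \<eta>\<close> \<epsilon>_def] w that(2) by blast
    moreover have "opt (\<lambda>i. {0, w i}) bs = opt (\<lambda>i. {0, ws ! i}) bs"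
      "ua_run \<phi> (\<lambda>i. {0, w i}) bs xs = ua_run \<phi> (\<lambda>i. {0, ws ! i}) bs xs"
      using that(1) by (auto simp: w_def intro!: opt_cong ua_run_cong)
    ultimately show ?thesis using xs by auto
  qed
  ultimately show "\<exists>\<epsilon>>0. \<forall>bs ws. length ws = length bs \<and> set bs \<subseteq> {L..U} \<and> set ws \<subseteq> {0<..\<epsilon>} \<longrightarrow>
      (\<exists>xs. ua_run \<phi> (\<lambda>i. {0, ws ! i}) bs xs \<and>
        opt (\<lambda>i. {0, ws ! i}) bs \<le> (\<alpha> + \<eta>) * gain bs xs)"
    by blast
qed

end

section \<open>Minimality of the parameter and of both competitive ratios, and uniqueness\<close>

theorem theorem2:
  fixes L U \<theta> :: real
  assumes "0 < L" and "L < U" and "\<theta> = U / L"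
  shows "is_arg_min (\<lambda>\<alpha>. \<alpha>) (\<lambda>\<alpha>. 1 \<le> \<alpha> \<and> (\<exists>\<phi>. admissible_threshold L U \<alpha> \<phi>)) (ln \<theta> + 1)
    \<and> is_arg_min (\<lambda>c. c)
        (\<lambda>c. \<exists>\<alpha>\<ge>1. \<exists>\<phi>. admissible_threshold L U \<alpha> \<phi> \<and> otp_competitive L U \<phi> c) (ln \<theta> + 1)
    \<and> is_arg_min (\<lambda>c. c)
        (\<lambda>c. \<exists>\<alpha>\<ge>1. \<exists>\<phi>. admissible_threshold L U \<alpha> \<phi> \<and> okp_competitive L U \<phi> c) (ln \<theta> + 1)
    \<and> (\<exists>!\<phi>. admissible_threshold L U (ln \<theta> + 1) \<phi>)"
proof -
  interpret optimal_parameter L U "ln \<theta> + 1"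
    using assms by unfold_locales simp_all
  note admissible = exp_threshold_admissible and ge1 = less_imp_le[OF alpha_gt_1]
  show ?thesis
  proof (intro conjI)
    show "is_arg_min (\<lambda>\<alpha>. \<alpha>) (\<lambda>\<alpha>. 1 \<le> \<alpha> \<and> (\<exists>\<phi>. admissible_threshold L U \<alpha> \<phi>)) (ln \<theta> + 1)"
      unfolding is_arg_min_def
      using admissible ge1 admissible_threshold_bound[OF assms(1,2)] assms(3) by fastforce
    show "is_arg_min (\<lambda>c. c)
        (\<lambda>c. \<exists>\<alpha>\<ge>1. \<exists>\<phi>. admissible_threshold L U \<alpha> \<phi> \<and> otp_competitive L U \<phi> c) (ln \<theta> + 1)"
      unfolding is_arg_min_def
      using admissible ge1 exp_threshold_otp_competitive otp_competitive_bound[OF assms(1,2)] assms(3)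
      by (metis linorder_not_le)
    show "is_arg_min (\<lambda>c. c)
        (\<lambda>c. \<exists>\<alpha>\<ge>1. \<exists>\<phi>. admissible_threshold L U \<alpha> \<phi> \<and> okp_competitive L U \<phi> c) (ln \<theta> + 1)"
      unfolding is_arg_min_def
      using admissible ge1 exp_threshold_okp_competitive okp_competitive_bound[OF assms(1,2)] assms(3)
      by (metis linorder_not_le)
    show "\<exists>!\<phi>. admissible_threshold L U (ln \<theta> + 1) \<phi>"
      using admissible admissible_threshold_unique by blast
  qed
qed

end
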